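(* Let $d,k,n$ be positive integers with $k\le n$, let $x_1,\dots,x_n\in\mathbb{R}^d$, let $X=(x_1,\dots,x_n)\in\mathbb{R}^{d\times n}$ and $c_0=\sum_{i=1}^n\|x_i\|^2$. The k-means problem $$\text{(P1)}\qquad \min_{\{y_j\}_{j=1}^k\subset\mathbb{R}^d,\ \Gamma\in\mathcal{A}}\ \sum_{i=1}^n\sum_{j=1}^k\|x_i-y_j\|^2\,\Gamma_{i,j}$$ is equivalent to the concave problem (minimization of a concave function over a convex set) $$\text{(P2)}\qquad \min_{\Gamma\in\overline{\mathcal{A}}}\ c_0-\sum_{j=1}^k\frac{\|X\Gamma e_j\|^2}{\mathbf{1}^T\Gamma e_j}$$ in the sense that there is a $\Gamma\in\mathcal{A}$ that minimizes both problems (that is, $\Gamma$ is a minimizer of (P2), and there are $y_1,\dots,y_k\in\mathbb{R}^d$ such that $(\{y_j\}_{j=1}^k,\Gamma)$ is a minimizer of (P1)), and the minimum values of (P1) and (P2) coincide.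
   Context: $\|\cdot\|$ is the Euclidean norm, $\mathbf{1}$ denotes the all-ones column vector of the appropriate dimension, $e_j\in\mathbb{R}^k$ is the $j$-th standard basis vector, and inequalities between vectors are entrywise. The set of assignment matrices is $$\mathcal{A}=\{\Gamma\in\{0,1\}^{n\times k}:\ \Gamma\mathbf{1}=\mathbf{1},\ \Gamma^T\mathbf{1}\ge\mathbf{1}\},$$ and its relaxation is $$\overline{\mathcal{A}}=\{\Gamma\in[0,1]^{n\times k}:\ \Gamma\mathbf{1}=\mathbf{1},\ \Gamma^T\mathbf{1}\ge\mathbf{1}\}.$$ For every $\Gamma\in\overline{\mathcal{A}}$ the denominators $\mathbf{1}^T\Gamma e_j$ are at least $1$. *)

theory Defs
  imports "HOL-Analysis.Analysis"
begin

(* The dimensions d, k, n are the cardinalities of the finite (hence nonempty) index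
   types 'd, 'k, 'n.  An n x k matrix has type real^'k^'n, with entry (i,j) given by
   \<Gamma> $ i $ j.  The vector 1 :: real^'m is the all-ones vector, and \<le> on vectors is
   the entrywise order. *)

definition assignment_matrices :: "(real^'k^'n) set" where
  "assignment_matrices =
     {\<Gamma>. (\<forall>i j. \<Gamma> $ i $ j \<in> {0, 1}) \<and> \<Gamma> *v 1 = 1 \<and> transpose \<Gamma> *v 1 \<ge> 1}"

definition relaxed_assignment_matrices :: "(real^'k^'n) set" where
  "relaxed_assignment_matrices =
     {\<Gamma>. (\<forall>i j. \<Gamma> $ i $ j \<in> {0..1}) \<and> \<Gamma> *v 1 = 1 \<and> transpose \<Gamma> *v 1 \<ge> 1}"

definition data_matrix :: "('n \<Rightarrow> real^'d) \<Rightarrow> real^'n^'d" where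
  "data_matrix x = (\<chi> l i. x i $ l)"

definition kmeans_objective ::
    "('n::finite \<Rightarrow> real^'d) \<Rightarrow> ('k::finite \<Rightarrow> real^'d) \<Rightarrow> real^'k^'n \<Rightarrow> real" where
  "kmeans_objective x y \<Gamma> =
     (\<Sum>i\<in>UNIV. \<Sum>j\<in>UNIV. (norm (x i - y j))\<^sup>2 * \<Gamma> $ i $ j)"

definition concave_objective :: "('n::finite \<Rightarrow> real^'d) \<Rightarrow> real^'k^'n \<Rightarrow> real" where
  "concave_objective x \<Gamma> =
     (\<Sum>i\<in>UNIV. (norm (x i))\<^sup>2) -
     (\<Sum>j\<in>UNIV. (norm (data_matrix x *v (\<Gamma> *v axis j 1)))\<^sup>2 / (1 \<bullet> (\<Gamma> *v axis j 1)))"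

end

theory Submission
  imports Defs
begin

text \<open>
  Fixing \<open>\<Gamma>\<close> and choosing the centres freely reduces k-means to the concave objective: by the
  parallel axis theorem, \<open>kmeans_objective x y \<Gamma>\<close> exceeds \<open>concave_objective x \<Gamma>\<close> by a weighted sum
  of squared distances of the centres from the centroids of their clusters
  (\<open>kmeans_eq_concave_plus_centroid_deviation\<close>). So the k-means minimum is the minimum of the concave
  objective over the finitely many assignment matrices, and the whole question is why relaxing to
  fractional matrices does not lower it.

  It does not because the relaxed set is the convex hull of the assignment matrices
  (\<open>relaxed_eq_convex_hull\<close>), and a concave function is bounded below on a convex hull by its
  minimum on the generating points. By the Krein-Milman theorem the hull description amounts to
  integrality of the extreme points (\<open>extreme_point_relaxed_imp_assignment\<close>). This is shown by a
  perturbation: if \<open>\<Gamma>\<close> has non-integral entries, there is a nonzero matrix \<open>E\<close>, supported on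
  them, whose row sums vanish and whose column sums vanish wherever the column constraint is tight
  (\<open>circulation_on_cells\<close>). Then \<open>\<Gamma>\<close> is the midpoint of \<open>\<Gamma> + \<epsilon>E\<close> and \<open>\<Gamma> - \<epsilon>E\<close>, which are
  both feasible for small \<open>\<epsilon>\<close>. The matrix \<open>E\<close> exists by counting dimensions: a line with an
  integral sum never has exactly one non-integral entry, so the non-integral entries outnumber
  the independent constraints on \<open>E\<close>.
\<close>

section \<open>Assignment matrices as the integral points of their relaxation\<close>

lemma mem_relaxed_iff:
  fixes \<Gamma> :: "real^'k^'n"
  shows "\<Gamma> \<in> relaxed_assignment_matrices \<longleftrightarrow>
    (\<forall>i j. 0 \<le> \<Gamma> $ i $ j) \<and> (\<forall>i. (\<Sum>j\<in>UNIV. \<Gamma> $ i $ j) = 1) \<and> (\<forall>j. 1 \<le> (\<Sum>i\<in>UNIV. \<Gamma> $ i $ j))"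
proof -
  have "\<Gamma> $ i $ j \<le> 1" if "\<forall>i j. 0 \<le> \<Gamma> $ i $ j" "\<forall>i. (\<Sum>j\<in>UNIV. \<Gamma> $ i $ j) = 1" for i j
    using member_le_sum[of j UNIV "\<lambda>j. \<Gamma> $ i $ j"] that by simp
  then show ?thesis
    by (auto simp: relaxed_assignment_matrices_def vec_eq_iff less_eq_vec_def
        matrix_vector_mult_def transpose_def)
qed

text \<open>
  Integrality, unlike membership in \<open>{0, 1}\<close>, passes from the entries of a line to its sum and
  back to a missing entry; the argument about extreme points rests on this form.
\<close>

lemma assignment_iff_relaxed_Ints:
  fixes \<Gamma> :: "real^'k^'n"
  shows "\<Gamma> \<in> assignment_matrices \<longleftrightarrow> \<Gamma> \<in> relaxed_assignment_matrices \<and> (\<forall>i j. \<Gamma> $ i $ j \<in> \<int>)"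
proof -
  have "t \<in> {0..1} \<and> t \<in> \<int> \<longleftrightarrow> t \<in> {0,1}" for t :: real
    by (auto elim!: Ints_cases)
  then show ?thesis
    unfolding assignment_matrices_def relaxed_assignment_matrices_def mem_Collect_eq by blast
qed

section \<open>Elimination of the centres\<close>

lemma concave_objective_alt:
  "concave_objective x \<Gamma> = (\<Sum>i\<in>UNIV. (norm (x i))\<^sup>2) -
     (\<Sum>j\<in>UNIV. (norm (\<Sum>i\<in>UNIV. \<Gamma> $ i $ j *\<^sub>R x i))\<^sup>2 / (\<Sum>i\<in>UNIV. \<Gamma> $ i $ j))"
proof -
  have "data_matrix x *v (\<Gamma> *v axis j 1) = (\<Sum>i\<in>UNIV. \<Gamma> $ i $ j *\<^sub>R x i)" for j
    unfolding matrix_vector_mult_basis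
    by (simp add: vec_eq_iff matrix_vector_mult_def data_matrix_def column_def mult.commute)
  moreover have "1 \<bullet> (\<Gamma> *v axis j 1) = (\<Sum>i\<in>UNIV. \<Gamma> $ i $ j)" for j
    by (simp add: matrix_vector_mult_basis column_def inner_vec_def)
  ultimately show ?thesis
    by (simp add: concave_objective_def)
qed

text \<open>
  The parallel axis theorem: moving the reference point away from the weighted mean costs the
  total weight times the squared displacement.
\<close>

lemma weighted_square_distances:
  fixes x :: "'i \<Rightarrow> 'v::real_inner"
  defines "m \<equiv> \<lambda>w I. \<Sum>i\<in>I. w i *\<^sub>R x i"
  assumes "sum w I \<noteq> 0"
  shows "(\<Sum>i\<in>I. (norm (x i - y))\<^sup>2 * w i) =
    (\<Sum>i\<in>I. (norm (x i))\<^sup>2 * w i) - (norm (m w I))\<^sup>2 / sum w I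
      + sum w I * (norm (y - m w I /\<^sub>R sum w I))\<^sup>2"
proof -
  have "(\<Sum>i\<in>I. (norm (x i - y))\<^sup>2 * w i)
    = (\<Sum>i\<in>I. (norm (x i))\<^sup>2 * w i) - 2 * (m w I \<bullet> y) + sum w I * (norm y)\<^sup>2"
    by (simp add: m_def power2_norm_eq_inner algebra_simps sum.distrib sum_subtractf inner_commute)
      (simp add: inner_sum_right sum_distrib_left sum_distrib_right mult.left_commute)
  moreover have "sum w I * (norm (y - m w I /\<^sub>R sum w I))\<^sup>2
    = sum w I * (norm y)\<^sup>2 - 2 * (m w I \<bullet> y) + (norm (m w I))\<^sup>2 / sum w I"
    using assms(2)
    by (simp add: power2_norm_eq_inner inner_diff_left inner_diff_right field_simps inner_commute)
  ultimately show ?thesis by simp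
qed

lemma kmeans_eq_concave_plus_centroid_deviation:
  fixes \<Gamma> :: "real^'k^'n" and x :: "'n::finite \<Rightarrow> real^'d"
  assumes "\<Gamma> \<in> relaxed_assignment_matrices"
  defines "s \<equiv> \<lambda>j. \<Sum>i\<in>UNIV. \<Gamma> $ i $ j"
  shows "kmeans_objective x y \<Gamma> = concave_objective x \<Gamma>
    + (\<Sum>j\<in>UNIV. s j * (norm (y j - (\<Sum>i\<in>UNIV. \<Gamma> $ i $ j *\<^sub>R x i) /\<^sub>R s j))\<^sup>2)"
proof -
  have s: "s j \<noteq> 0" for j
    using assms(1) unfolding mem_relaxed_iff s_def by (metis not_one_le_zero)
  have "kmeans_objective x y \<Gamma> = (\<Sum>j\<in>UNIV. \<Sum>i\<in>UNIV. (norm (x i - y j))\<^sup>2 * \<Gamma> $ i $ j)"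
    unfolding kmeans_objective_def by (rule sum.swap)
  also have "\<dots> = (\<Sum>j\<in>UNIV. (\<Sum>i\<in>UNIV. (norm (x i))\<^sup>2 * \<Gamma> $ i $ j)
      - (norm (\<Sum>i\<in>UNIV. \<Gamma> $ i $ j *\<^sub>R x i))\<^sup>2 / s j
      + s j * (norm (y j - (\<Sum>i\<in>UNIV. \<Gamma> $ i $ j *\<^sub>R x i) /\<^sub>R s j))\<^sup>2)"
    using weighted_square_distances[OF s[unfolded s_def], of x] by (simp add: s_def)
  also have "(\<Sum>j\<in>UNIV. \<Sum>i\<in>UNIV. (norm (x i))\<^sup>2 * \<Gamma> $ i $ j) = (\<Sum>i\<in>UNIV. (norm (x i))\<^sup>2)"
    using assms(1) by (subst sum.swap) (simp add: mem_relaxed_iff flip: sum_distrib_left)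
  ultimately show ?thesis
    by (simp add: concave_objective_alt s_def sum.distrib sum_subtractf)
qed

section \<open>Concavity of the objective\<close>

text \<open>
  The function \<open>(p, s) \<mapsto> \<parallel>p\<parallel>\<^sup>2 / s\<close> is homogeneous of degree one, so its
  convexity on \<open>s > 0\<close> is the same as this subadditivity. The gap between the two sides is
  \<open>\<parallel>r p - s q\<parallel>\<^sup>2 / (s r (s + r))\<close>.
\<close>

lemma square_over_linear_subadditive:
  fixes p q :: "'v::real_inner"
  assumes "0 < s" "0 < r"
  shows "(norm (p + q))\<^sup>2 / (s + r) \<le> (norm p)\<^sup>2 / s + (norm q)\<^sup>2 / r"
proof -
  have "(norm p)\<^sup>2 / s + (norm q)\<^sup>2 / r - (norm (p + q))\<^sup>2 / (s + r)
     = (norm (r *\<^sub>R p - s *\<^sub>R q))\<^sup>2 / (s * r * (s + r))"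
    using assms add_pos_pos[OF assms]
    by (simp add: power2_norm_eq_inner inner_add_left inner_add_right inner_diff_left
        inner_diff_right divide_simps inner_commute) (simp add: algebra_simps inner_commute)
  moreover have "\<dots> \<ge> 0" using assms by simp
  ultimately show ?thesis by linarith
qed

lemma convex_relaxed: "convex (relaxed_assignment_matrices :: (real^'k^'n) set)"
proof (rule convexI)
  fix A B :: "real^'k^'n" and u v :: real
  assume AB: "A \<in> relaxed_assignment_matrices" "B \<in> relaxed_assignment_matrices"
    and uv: "0 \<le> u" "0 \<le> v" "u + v = 1"
  have "1 \<le> u * (\<Sum>i\<in>UNIV. A $ i $ j) + v * (\<Sum>i\<in>UNIV. B $ i $ j)" for j
    using AB uv convex_bound_le[of "- (\<Sum>i\<in>UNIV. A $ i $ j)" "-1" "- (\<Sum>i\<in>UNIV. B $ i $ j)" u v]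
    by (simp add: mem_relaxed_iff)
  then show "u *\<^sub>R A + v *\<^sub>R B \<in> relaxed_assignment_matrices"
    using AB uv by (simp add: mem_relaxed_iff sum.distrib flip: sum_distrib_left)
qed

text \<open>
  Weighted sum and total weight of a cluster are linear in \<open>\<Gamma>\<close>, so each cluster subtracts a
  convex function.
\<close>

lemma concave_on_concave_objective:
  "concave_on (relaxed_assignment_matrices :: (real^'k^'n) set) (concave_objective x)"
  unfolding concave_on_def
proof (rule convex_onI)
  fix t :: real and A B :: "real^'k^'n"
  assume t: "0 < t" "t < 1"
    and AB: "A \<in> relaxed_assignment_matrices" "B \<in> relaxed_assignment_matrices"
  define s where "s \<Gamma> j = (\<Sum>i\<in>UNIV. \<Gamma> $ i $ j)" for \<Gamma> :: "real^'k^'n" and j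
  define m where "m \<Gamma> j = (\<Sum>i\<in>UNIV. \<Gamma> $ i $ j *\<^sub>R x i)" for \<Gamma> :: "real^'k^'n" and j
  let ?C = "(1 - t) *\<^sub>R A + t *\<^sub>R B"
  have term_le: "(norm (m ?C j))\<^sup>2 / s ?C j
      \<le> (1 - t) * ((norm (m A j))\<^sup>2 / s A j) + t * ((norm (m B j))\<^sup>2 / s B j)" for j
  proof -
    have pos: "0 < s A j" "0 < s B j"
      using AB unfolding mem_relaxed_iff s_def by (metis less_le_trans zero_less_one)+
    have "m ?C j = (1 - t) *\<^sub>R m A j + t *\<^sub>R m B j" "s ?C j = (1 - t) * s A j + t * s B j"
      by (simp_all add: m_def s_def algebra_simps sum.distrib sum_subtractf scaleR_sum_right
          sum_distrib_left)
    then have "(norm (m ?C j))\<^sup>2 / s ?C j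
      \<le> (norm ((1 - t) *\<^sub>R m A j))\<^sup>2 / ((1 - t) * s A j) + (norm (t *\<^sub>R m B j))\<^sup>2 / (t * s B j)"
      using square_over_linear_subadditive[of "(1 - t) * s A j" "t * s B j"] t pos
      by (simp del: norm_scaleR)
    also have "\<dots> = (1 - t) * ((norm (m A j))\<^sup>2 / s A j) + t * ((norm (m B j))\<^sup>2 / s B j)"
      using t pos by (simp add: power2_eq_square mult_ac)
    finally show ?thesis .
  qed
  have "(\<Sum>j\<in>UNIV. (norm (m ?C j))\<^sup>2 / s ?C j)
      \<le> (1 - t) * (\<Sum>j\<in>UNIV. (norm (m A j))\<^sup>2 / s A j) + t * (\<Sum>j\<in>UNIV. (norm (m B j))\<^sup>2 / s B j)"
    unfolding sum_distrib_left sum.distrib[symmetric] by (rule sum_mono) (rule term_le)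
  then show "- concave_objective x ?C \<le> (1 - t) * - concave_objective x A + t * - concave_objective x B"
    unfolding concave_objective_alt s_def[symmetric] m_def[symmetric]
    by (simp add: algebra_simps)
qed (rule convex_relaxed)

section \<open>Compactness and finiteness\<close>

lemma compact_relaxed: "compact (relaxed_assignment_matrices :: (real^'k^'n) set)"
  unfolding compact_eq_bounded_closed
proof
  have "norm \<Gamma> \<le> real CARD('n) * real CARD('k)"
    if "\<Gamma> \<in> relaxed_assignment_matrices" for \<Gamma> :: "real^'k^'n"
  proof -
    have "norm (\<Gamma> $ i) \<le> real CARD('k)" for i
    proof -
      have "norm (\<Gamma> $ i) \<le> (\<Sum>j\<in>UNIV. \<bar>\<Gamma> $ i $ j\<bar>)" by (rule norm_le_l1_cart)
      also have "\<dots> \<le> (\<Sum>j\<in>(UNIV::'k set). 1)"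
        using that by (intro sum_mono) (simp add: relaxed_assignment_matrices_def)
      finally show ?thesis by simp
    qed
    then have "(\<Sum>i\<in>UNIV. norm (\<Gamma> $ i)) \<le> (\<Sum>i\<in>(UNIV::'n set). real CARD('k))"
      by (intro sum_mono)
    moreover have "norm \<Gamma> \<le> (\<Sum>i\<in>UNIV. norm (\<Gamma> $ i))"
      unfolding norm_vec_def by (rule L2_set_le_sum) simp
    ultimately show ?thesis by simp
  qed
  then show "bounded (relaxed_assignment_matrices :: (real^'k^'n) set)"
    unfolding bounded_iff by blast
  have "(relaxed_assignment_matrices :: (real^'k^'n) set) = {\<Gamma>. (\<forall>i j. 0 \<le> \<Gamma> $ i $ j)
      \<and> (\<forall>i. (\<Sum>j\<in>UNIV. \<Gamma> $ i $ j) = 1) \<and> (\<forall>j. 1 \<le> (\<Sum>i\<in>UNIV. \<Gamma> $ i $ j))}"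
    using mem_relaxed_iff by blast
  also have "closed \<dots>"
    by (intro closed_Collect_conj closed_Collect_all closed_Collect_le closed_Collect_eq
        continuous_intros)
  finally show "closed (relaxed_assignment_matrices :: (real^'k^'n) set)" .
qed

text \<open>
  An injection of the clusters into the points has a left inverse, which sends the points onto
  the clusters.
\<close>

lemma assignment_matrices_nonempty:
  assumes "CARD('k::finite) \<le> CARD('n::finite)"
  shows "(assignment_matrices :: (real^'k^'n) set) \<noteq> {}"
proof -
  obtain h :: "'k \<Rightarrow> 'n" where "inj h"
    using card_le_inj[of "UNIV::'k set" "UNIV::'n set"] assms by auto
  define \<Gamma> :: "real^'k^'n" where "\<Gamma> = (\<chi> i j. if inv h i = j then 1 else 0)"
  have "1 \<le> (\<Sum>i\<in>UNIV. \<Gamma> $ i $ j)" for j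
    using member_le_sum[of "h j" UNIV "\<lambda>i. \<Gamma> $ i $ j"] \<open>inj h\<close> by (simp add: \<Gamma>_def)
  then have "\<Gamma> \<in> assignment_matrices"
    unfolding assignment_iff_relaxed_Ints mem_relaxed_iff by (simp add: \<Gamma>_def)
  then show ?thesis by blast
qed

lemma finite_assignment_matrices: "finite (assignment_matrices :: (real^'k^'n) set)"
proof (rule finite_subset)
  have "\<exists>P. \<Gamma> = (\<chi> i j. if P i j then 1 else 0)"
    if "\<Gamma> \<in> assignment_matrices" for \<Gamma> :: "real^'k^'n"
    using that
    by (intro exI[of _ "\<lambda>i j. \<Gamma> $ i $ j = 1"]) (auto simp: assignment_matrices_def vec_eq_iff)
  then show "(assignment_matrices :: (real^'k^'n) set)
      \<subseteq> range (\<lambda>P::'n \<Rightarrow> 'k \<Rightarrow> bool. \<chi> i j. if P i j then 1 else 0)"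
    by blast
qed simp

section \<open>Extreme points of the relaxation\<close>

text \<open>
  A perturbation \<open>b\<close> that vanishes on the tight constraints can be scaled down to fit into all
  the slacks \<open>a\<close> at once.
\<close>

lemma uniform_scaling:
  fixes a b :: "'p \<Rightarrow> real"
  assumes "finite A" "\<And>p. p \<in> A \<Longrightarrow> 0 \<le> a p" "\<And>p. p \<in> A \<Longrightarrow> a p = 0 \<Longrightarrow> b p = 0"
  obtains \<epsilon> where "0 < \<epsilon>" "\<And>p. p \<in> A \<Longrightarrow> \<epsilon> * \<bar>b p\<bar> \<le> a p"
proof -
  have "\<forall>p\<in>A. \<forall>\<^sub>F \<epsilon> in at_right 0. \<epsilon> * \<bar>b p\<bar> \<le> a p"
  proof
    fix p assume p: "p \<in> A"
    show "\<forall>\<^sub>F \<epsilon> in at_right 0. \<epsilon> * \<bar>b p\<bar> \<le> a p"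
    proof (cases "a p = 0")
      case False
      have "((\<lambda>\<epsilon>. \<epsilon> * \<bar>b p\<bar>) \<longlongrightarrow> 0 * \<bar>b p\<bar>) (at_right 0)"
        by (intro tendsto_intros)
      then have "\<forall>\<^sub>F \<epsilon> in at_right 0. \<epsilon> * \<bar>b p\<bar> < a p"
        using assms(2)[OF p] False by (intro order_tendstoD) auto
      then show ?thesis by (rule eventually_mono) simp
    qed (use assms(3)[OF p] in simp)
  qed
  then have "\<forall>\<^sub>F \<epsilon> in at_right 0. (0::real) < \<epsilon> \<and> (\<forall>p\<in>A. \<epsilon> * \<bar>b p\<bar> \<le> a p)"
    by (intro eventually_conj eventually_at_right_less eventually_ball_finite assms(1))
  then show ?thesis
    using that eventually_happens trivial_limit_at_right_real by blast
qed



lemma sum_Ints_other_nonint: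
  fixes a :: "'i \<Rightarrow> real"
  assumes "finite A" "sum a A \<in> \<int>" "i \<in> A" "a i \<notin> \<int>"
  obtains j where "j \<in> A" "j \<noteq> i" "a j \<notin> \<int>"
proof (rule ccontr)
  assume "\<not> thesis"
  then have "(\<Sum>j\<in>A - {i}. a j) \<in> \<int>"
    by (intro Ints_sum) (use that in blast)
  then have "sum a A - (\<Sum>j\<in>A - {i}. a j) \<in> \<int>"
    using assms(2) by (rule Ints_diff[rotated])
  then show False
    using assms by (simp add: sum.remove)
qed

text \<open>
  The cells \<open>F\<close> are unknowns, the rows \<open>fst ` F\<close> and the columns \<open>C\<close> linear equations. As every
  constrained line has two cells, \<open>2 |F| \<ge> 2 (|fst ` F| + |C|)\<close>, so there are never more equations
  than unknowns. If some column meeting \<open>F\<close> is unconstrained, its cells make the inequality strict.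
  Otherwise all lines meeting \<open>F\<close> are constrained, and one equation is redundant because the row
  sums and the column sums have the same total. Either way a nonzero solution remains.
\<close>

lemma circulation_on_cells:
  fixes F :: "('n::finite \<times> 'k::finite) set"
  assumes "F \<noteq> {}"
    and rows: "\<And>i. i \<in> fst ` F \<Longrightarrow> 2 \<le> card {j. (i, j) \<in> F}"
    and C: "C \<subseteq> snd ` F"
    and cols: "\<And>j. j \<in> C \<Longrightarrow> 2 \<le> card {i. (i, j) \<in> F}"
  obtains E :: "real^'k^'n"
  where "E \<noteq> 0" "\<And>i j. (i, j) \<notin> F \<Longrightarrow> E $ i $ j = 0"
    "\<And>i. (\<Sum>j\<in>UNIV. E $ i $ j) = 0" "\<And>j. j \<in> C \<Longrightarrow> (\<Sum>i\<in>UNIV. E $ i $ j) = 0"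
proof -
  define unit :: "'n \<times> 'k \<Rightarrow> real^'k^'n" where "unit = (\<lambda>(i, j). axis i (axis j 1))"
  define row where "row i = (\<Sum>j | (i, j) \<in> F. unit (i, j))" for i
  define col where "col j = (\<Sum>i | (i, j) \<in> F. unit (i, j))" for j
  have unit_inner: "E \<bullet> unit (i, j) = E $ i $ j" for E i j
    by (simp add: unit_def inner_axis)
  have "inj unit"
    by (auto simp: inj_def unit_def axis_eq_axis)
  have "unit ` F \<subseteq> Basis"
    by (auto simp: unit_def Basis_vec_def)
  then have "independent (unit ` F)"
    using independent_Basis independent_mono by blast
  then have dim_F: "dim (span (unit ` F)) = card F"
    using \<open>inj unit\<close> by (simp add: dim_eq_card_independent card_image inj_on_subset)
  have supp: "E $ i $ j = 0" if "E \<in> span (unit ` F)" "(i, j) \<notin> F" for E i j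
    using that(1)
  proof (induction rule: span_induct_alt)
    case (step c b E)
    then show ?case using that(2) by (auto simp: unit_def axis_def split: if_splits)
  qed simp
  have row_inner: "E \<bullet> row i = (\<Sum>j\<in>UNIV. E $ i $ j)" if "E \<in> span (unit ` F)" for E i
    unfolding row_def inner_sum_right unit_inner
    by (rule sum.mono_neutral_left) (use supp[OF that] in auto)
  have col_inner: "E \<bullet> col j = (\<Sum>i\<in>UNIV. E $ i $ j)" if "E \<in> span (unit ` F)" for E j
    unfolding col_def inner_sum_right unit_inner
    by (rule sum.mono_neutral_left) (use supp[OF that] in auto)
  \<comment> \<open>Orthogonality to fewer than \<open>|F|\<close> vectors leaves a nonzero solution in the span of the cells.\<close>
  have kernel: "\<exists>E \<in> span (unit ` F). E \<noteq> 0 \<and> (\<forall>i\<in>R'. (\<Sum>j\<in>UNIV. E $ i $ j) = 0)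
      \<and> (\<forall>j\<in>C. (\<Sum>i\<in>UNIV. E $ i $ j) = 0)"
    if "card R' + card C < card F" for R'
  proof -
    define S where "S = row ` R' \<union> col ` C"
    have "row i \<in> span (unit ` F)" "col j \<in> span (unit ` F)" for i j
      unfolding row_def col_def by (auto intro!: span_sum intro: span_base)
    then have sub: "span S \<subseteq> span (unit ` F)"
      unfolding S_def by (intro span_minimal subspace_span) auto
    have "dim (span S) \<le> card S"
      by (simp add: dim_le_card' S_def)
    also have "\<dots> \<le> card R' + card C"
      unfolding S_def by (intro order_trans[OF card_Un_le] add_mono card_image_le) auto
    also have "\<dots> < dim (span (unit ` F))"
      using that dim_F by simp
    finally have "span S \<subset> span (unit ` F)"
      using sub by (metis less_irrefl psubsetI)
    then obtain E where "E \<noteq> 0" and E: "E \<in> span (unit ` F)" "\<And>y. y \<in> span S \<Longrightarrow> orthogonal E y"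
      using orthogonal_to_subspace_exists_gen by blast
    have "E \<bullet> v = 0" if "v \<in> S" for v
      using E(2)[OF span_base[OF that]] by (simp add: orthogonal_def)
    then show ?thesis
      using \<open>E \<noteq> 0\<close> E(1) row_inner[OF E(1)] col_inner[OF E(1)]
      by (intro bexI[of _ E]) (force simp: S_def)+
  qed
  let ?R = "fst ` F"
  have "card F = (\<Sum>i\<in>?R. card {j. (i, j) \<in> F})"
  proof -
    have "F = Sigma ?R (\<lambda>i. {j. (i, j) \<in> F})" by force
    then show ?thesis by (metis card_SigmaI finite)
  qed
  then have card_rows: "2 * card ?R \<le> card F"
    using sum_mono[of ?R "\<lambda>_. 2" "\<lambda>i. card {j. (i, j) \<in> F}"] rows by simp
  have card_cols: "card F = (\<Sum>j\<in>snd ` F. card {i. (i, j) \<in> F})"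
  proof -
    have "prod.swap ` F = Sigma (snd ` F) (\<lambda>j. {i. (i, j) \<in> F})" by force
    then have "card (prod.swap ` F) = (\<Sum>j\<in>snd ` F. card {i. (i, j) \<in> F})"
      by (metis card_SigmaI finite)
    then show ?thesis by (simp add: card_image)
  qed
  have card_C: "2 * card C \<le> (\<Sum>j\<in>C. card {i. (i, j) \<in> F})"
    using sum_mono[of C "\<lambda>_. 2" "\<lambda>j. card {i. (i, j) \<in> F}"] cols by simp
  have sums: "(\<Sum>i\<in>?R. \<Sum>j\<in>UNIV. E $ i $ j) = (\<Sum>j\<in>snd ` F. \<Sum>i\<in>UNIV. E $ i $ j)"
    if "E \<in> span (unit ` F)" for E
  proof -
    have "(\<Sum>i\<in>?R. \<Sum>j\<in>UNIV. E $ i $ j) = (\<Sum>i\<in>UNIV. \<Sum>j\<in>UNIV. E $ i $ j)"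
      by (rule sum.mono_neutral_left) (force intro!: sum.neutral supp[OF that])+
    also have "\<dots> = (\<Sum>j\<in>UNIV. \<Sum>i\<in>UNIV. E $ i $ j)"
      by (rule sum.swap)
    also have "\<dots> = (\<Sum>j\<in>snd ` F. \<Sum>i\<in>UNIV. E $ i $ j)"
      by (rule sum.mono_neutral_right) (force intro!: sum.neutral supp[OF that])+
    finally show ?thesis .
  qed
  have "\<exists>E \<in> span (unit ` F). E \<noteq> 0 \<and> (\<forall>i\<in>?R. (\<Sum>j\<in>UNIV. E $ i $ j) = 0)
      \<and> (\<forall>j\<in>C. (\<Sum>i\<in>UNIV. E $ i $ j) = 0)"
  proof (cases "C = snd ` F")
    case False
    then obtain j where j: "j \<in> snd ` F" "j \<notin> C" using C by blast
    then have "card {i. (i, j) \<in> F} > 0"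
      by (force simp: card_gt_0_iff)
    \<comment> \<open>One cell in a column outside \<open>C\<close> already makes the count strict.\<close>
    then have "2 * card C < (\<Sum>j\<in>insert j C. card {i. (i, j) \<in> F})"
      using card_C j by simp
    also have "\<dots> \<le> card F"
      unfolding card_cols by (rule sum_mono2) (use j C in auto)
    finally show ?thesis
      using card_rows by (intro kernel) simp
  next
    case True
    \<comment> \<open>Drop the equation of one row \<open>r\<close>; it follows from all the others.\<close>
    obtain r where r: "r \<in> ?R" using \<open>F \<noteq> {}\<close> by auto
    then have "card (?R - {r}) < card ?R"
      by (intro card_Diff1_less) simp
    then have "card (?R - {r}) + card C < card F"
      using card_rows card_C card_cols True by simp
    then obtain E where E: "E \<in> span (unit ` F)" "E \<noteq> 0"
        "\<forall>i\<in>?R - {r}. (\<Sum>j\<in>UNIV. E $ i $ j) = 0" "\<forall>j\<in>C. (\<Sum>i\<in>UNIV. E $ i $ j) = 0"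
      using kernel by blast
    have "(\<Sum>i\<in>?R. \<Sum>j\<in>UNIV. E $ i $ j) = (\<Sum>j\<in>UNIV. E $ r $ j)"
      using E(3) r by (simp add: sum.remove[of ?R r])
    then have "(\<Sum>j\<in>UNIV. E $ r $ j) = 0"
      using sums[OF E(1)] E(4) True by simp
    then show ?thesis using E by blast
  qed
  then obtain E where E: "E \<in> span (unit ` F)" "E \<noteq> 0"
      "\<And>i. i \<in> ?R \<Longrightarrow> (\<Sum>j\<in>UNIV. E $ i $ j) = 0" "\<And>j. j \<in> C \<Longrightarrow> (\<Sum>i\<in>UNIV. E $ i $ j) = 0"
    by blast
  have "(\<Sum>j\<in>UNIV. E $ i $ j) = 0" for i
  proof (cases "i \<in> ?R")
    case False
    then have "(i, j) \<notin> F" for j by force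
    then show ?thesis using supp[OF E(1)] by simp
  qed (rule E(3))
  then show ?thesis
    using that[OF E(2) supp[OF E(1)]] E(4) by blast
qed

text \<open>
  A row has sum 1, and so does a tight column; by \<open>sum_Ints_other_nonint\<close> each of these meets the
  non-integral entries in none or at least two cells. So there is a circulation on those
  entries that respects the tight constraints, and \<open>\<Gamma>\<close> can move along it in both directions.
\<close>

lemma extreme_point_relaxed_imp_assignment:
  fixes \<Gamma> :: "real^'k^'n"
  assumes "\<Gamma> extreme_point_of relaxed_assignment_matrices"
  shows "\<Gamma> \<in> assignment_matrices"
proof (rule ccontr)
  assume not_assignment: "\<Gamma> \<notin> assignment_matrices"
  have \<Gamma>: "\<Gamma> \<in> relaxed_assignment_matrices"
    using assms by (simp add: extreme_point_of_def)
  define F where "F = {(i, j). \<Gamma> $ i $ j \<notin> \<int>}"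
  define C where "C = {j \<in> snd ` F. (\<Sum>i\<in>UNIV. \<Gamma> $ i $ j) = 1}"
  have two: "2 \<le> card A" if "a \<in> A" "b \<in> A" "a \<noteq> b" "finite A" for a b :: 'z and A
    using card_mono[of A "{a, b}"] that by simp
  have F_ne: "F \<noteq> {}"
    using not_assignment \<Gamma> by (auto simp: F_def assignment_iff_relaxed_Ints)
  have rows: "2 \<le> card {j. (i, j) \<in> F}" if i: "i \<in> fst ` F" for i
  proof -
    obtain j where j: "(i, j) \<in> F" using i by force
    have "(\<Sum>j\<in>UNIV. \<Gamma> $ i $ j) \<in> \<int>" using \<Gamma> by (simp add: mem_relaxed_iff)
    then obtain j' where "j' \<noteq> j" "(i, j') \<in> F"
      using sum_Ints_other_nonint[of UNIV "\<lambda>j. \<Gamma> $ i $ j" j] j by (auto simp: F_def)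
    with j show ?thesis by (intro two[of j _ j']) auto
  qed
  have C_sub: "C \<subseteq> snd ` F" by (auto simp: C_def)
  have cols: "2 \<le> card {i. (i, j) \<in> F}" if j: "j \<in> C" for j
  proof -
    obtain i where i: "(i, j) \<in> F" using j by (force simp: C_def)
    have "(\<Sum>i\<in>UNIV. \<Gamma> $ i $ j) \<in> \<int>" using j by (simp add: C_def)
    then obtain i' where "i' \<noteq> i" "(i', j) \<in> F"
      using sum_Ints_other_nonint[of UNIV "\<lambda>i. \<Gamma> $ i $ j" i] i by (auto simp: F_def)
    with i show ?thesis by (intro two[of i _ i']) auto
  qed
  obtain E :: "real^'k^'n"
    where E: "E \<noteq> 0" "\<And>i j. (i, j) \<notin> F \<Longrightarrow> E $ i $ j = 0"
      "\<And>i. (\<Sum>j\<in>UNIV. E $ i $ j) = 0" "\<And>j. j \<in> C \<Longrightarrow> (\<Sum>i\<in>UNIV. E $ i $ j) = 0"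
    using circulation_on_cells[OF F_ne rows C_sub cols] by metis
  obtain \<delta> where \<delta>: "0 < \<delta>" "\<And>i j. \<delta> * \<bar>E $ i $ j\<bar> \<le> \<Gamma> $ i $ j"
  proof (rule uniform_scaling[of UNIV "\<lambda>(i, j). \<Gamma> $ i $ j" "\<lambda>(i, j). E $ i $ j"])
    show "(case p of (i, j) \<Rightarrow> E $ i $ j) = 0" if "(case p of (i, j) \<Rightarrow> \<Gamma> $ i $ j) = 0" for p
      using that E(2)[of "fst p" "snd p"] by (auto simp: F_def split: prod.splits)
  qed (use \<Gamma> that in \<open>auto simp: mem_relaxed_iff\<close>)
  obtain \<eta> where \<eta>: "0 < \<eta>"
      "\<And>j. \<eta> * \<bar>\<Sum>i\<in>UNIV. E $ i $ j\<bar> \<le> (\<Sum>i\<in>UNIV. \<Gamma> $ i $ j) - 1"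
  proof (rule uniform_scaling[of UNIV "\<lambda>j. (\<Sum>i\<in>UNIV. \<Gamma> $ i $ j) - 1" "\<lambda>j. \<Sum>i\<in>UNIV. E $ i $ j"])
    show "(\<Sum>i\<in>UNIV. E $ i $ j) = 0" if "(\<Sum>i\<in>UNIV. \<Gamma> $ i $ j) - 1 = 0" for j
    proof (cases "j \<in> C")
      case False
      then have "(i, j) \<notin> F" for i using that by (force simp: C_def)
      then show ?thesis using E(2) by simp
    qed (rule E(4))
  qed (use \<Gamma> that in \<open>auto simp: mem_relaxed_iff\<close>)
  define \<epsilon> where "\<epsilon> = min \<delta> \<eta>"
  have \<epsilon>: "0 < \<epsilon>" "\<epsilon> * \<bar>E $ i $ j\<bar> \<le> \<Gamma> $ i $ j"
      "\<epsilon> * \<bar>\<Sum>i\<in>UNIV. E $ i $ j\<bar> \<le> (\<Sum>i\<in>UNIV. \<Gamma> $ i $ j) - 1" for i j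
    using \<delta>(1) \<eta>(1) order_trans[OF mult_right_mono \<delta>(2), of \<epsilon> i j]
      order_trans[OF mult_right_mono \<eta>(2), of \<epsilon> j]
    by (simp_all add: \<epsilon>_def)
  have shift: "\<Gamma> + c *\<^sub>R E \<in> relaxed_assignment_matrices" if "\<bar>c\<bar> = \<epsilon>" for c
  proof -
    have "0 \<le> \<Gamma> $ i $ j + c * E $ i $ j" for i j
      using \<epsilon>(2)[of i j] abs_ge_minus_self[of "c * E $ i $ j"] that by (simp add: abs_mult)
    moreover have "1 \<le> (\<Sum>i\<in>UNIV. \<Gamma> $ i $ j) + c * (\<Sum>i\<in>UNIV. E $ i $ j)" for j
      using \<epsilon>(3)[of j] abs_ge_minus_self[of "c * (\<Sum>i\<in>UNIV. E $ i $ j)"] that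
      by (simp add: abs_mult)
    ultimately show ?thesis
      using \<Gamma> E(3) by (simp add: mem_relaxed_iff sum.distrib flip: sum_distrib_left)
  qed
  have "\<Gamma> + \<epsilon> *\<^sub>R E \<in> relaxed_assignment_matrices" "\<Gamma> + (- \<epsilon>) *\<^sub>R E \<in> relaxed_assignment_matrices"
    using \<epsilon>(1) by (intro shift; simp)+
  moreover have "\<Gamma> \<in> open_segment (\<Gamma> + \<epsilon> *\<^sub>R E) (\<Gamma> + (- \<epsilon>) *\<^sub>R E)"
  proof -
    have "midpoint (\<Gamma> + \<epsilon> *\<^sub>R E) (\<Gamma> + (- \<epsilon>) *\<^sub>R E) = \<Gamma>"
      by (simp add: midpoint_def flip: scaleR_2)
    moreover have "\<Gamma> + \<epsilon> *\<^sub>R E \<noteq> \<Gamma> + (- \<epsilon>) *\<^sub>R E"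
      unfolding add_left_cancel scaleR_cancel_right using \<epsilon>(1) E(1) by simp
    ultimately show ?thesis
      by (metis midpoint_in_open_segment)
  qed
  ultimately show False
    using assms by (auto simp: extreme_point_of_def)
qed

section \<open>Equality of the two minima\<close>

lemma relaxed_eq_convex_hull:
  "(relaxed_assignment_matrices :: (real^'k^'n) set) = convex hull assignment_matrices"
proof
  have "(relaxed_assignment_matrices :: (real^'k^'n) set)
      = convex hull {\<Gamma>. \<Gamma> extreme_point_of relaxed_assignment_matrices}"
    by (rule Krein_Milman_Minkowski[OF compact_relaxed convex_relaxed])
  also have "\<dots> \<subseteq> convex hull assignment_matrices"
    by (rule hull_mono) (auto intro: extreme_point_relaxed_imp_assignment)
  finally show "(relaxed_assignment_matrices :: (real^'k^'n) set)
      \<subseteq> convex hull assignment_matrices" .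
  show "convex hull (assignment_matrices :: (real^'k^'n) set) \<subseteq> relaxed_assignment_matrices"
    by (rule hull_minimal) (auto simp: assignment_iff_relaxed_Ints convex_relaxed)
qed

theorem proposition2p1:
  fixes x :: "'n::finite \<Rightarrow> real^'d"
  assumes "CARD('k::finite) \<le> CARD('n)"
  shows "convex (relaxed_assignment_matrices :: (real^'k^'n) set)
       \<and> concave_on (relaxed_assignment_matrices :: (real^'k^'n) set) (concave_objective x)
       \<and> (\<exists>(\<Gamma> :: real^'k^'n) (y :: 'k \<Rightarrow> real^'d).
            \<Gamma> \<in> assignment_matrices
          \<and> is_arg_min (concave_objective x) (\<lambda>\<Gamma>'. \<Gamma>' \<in> relaxed_assignment_matrices) \<Gamma>
          \<and> is_arg_min (\<lambda>(y', \<Gamma>'). kmeans_objective x y' \<Gamma>')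
                       (\<lambda>(y', \<Gamma>'). \<Gamma>' \<in> assignment_matrices) (y, \<Gamma>)
          \<and> kmeans_objective x y \<Gamma> = concave_objective x \<Gamma>)"
proof -
  let ?f = "concave_objective x :: real^'k^'n \<Rightarrow> real"
  obtain \<Gamma> :: "real^'k^'n" where \<Gamma>: "\<Gamma> \<in> assignment_matrices"
      and \<Gamma>_min: "\<And>\<Gamma>'. \<Gamma>' \<in> assignment_matrices \<Longrightarrow> ?f \<Gamma> \<le> ?f \<Gamma>'"
    using arg_min_if_finite[OF finite_assignment_matrices assignment_matrices_nonempty[OF assms], of ?f]
    by (meson not_less)
  have relaxed_min: "?f \<Gamma> \<le> ?f \<Gamma>'" if "\<Gamma>' \<in> relaxed_assignment_matrices" for \<Gamma>'
  proof -
    have "\<forall>\<Gamma>' \<in> convex hull assignment_matrices. - ?f \<Gamma>' \<le> - ?f \<Gamma>"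
    proof (rule convex_on_convex_hull_bound)
      show "convex_on (convex hull assignment_matrices) (\<lambda>\<Gamma>. - ?f \<Gamma>)"
        using concave_on_concave_objective[of x]
        unfolding concave_on_def relaxed_eq_convex_hull .
    qed (use \<Gamma>_min in simp)
    then show ?thesis
      using that unfolding relaxed_eq_convex_hull by simp
  qed
  have relaxed: "\<Gamma>' \<in> relaxed_assignment_matrices" if "\<Gamma>' \<in> assignment_matrices" for \<Gamma>' :: "real^'k^'n"
    using that by (simp add: assignment_iff_relaxed_Ints)
  have kmeans_ge: "?f \<Gamma>' \<le> kmeans_objective x y' \<Gamma>'" if "\<Gamma>' \<in> assignment_matrices" for y' \<Gamma>'
  proof -
    have "0 \<le> (\<Sum>i\<in>UNIV. \<Gamma>' $ i $ j)" for j
      using relaxed[OF that] by (simp add: mem_relaxed_iff sum_nonneg)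
    then show ?thesis
      unfolding kmeans_eq_concave_plus_centroid_deviation[OF relaxed[OF that]]
      by (simp add: sum_nonneg)
  qed
  define y where "y j = (\<Sum>i\<in>UNIV. \<Gamma> $ i $ j *\<^sub>R x i) /\<^sub>R (\<Sum>i\<in>UNIV. \<Gamma> $ i $ j)" for j
  have eq: "kmeans_objective x y \<Gamma> = ?f \<Gamma>"
    unfolding kmeans_eq_concave_plus_centroid_deviation[OF relaxed[OF \<Gamma>]] y_def by simp
  have "is_arg_min ?f (\<lambda>\<Gamma>'. \<Gamma>' \<in> relaxed_assignment_matrices) \<Gamma>"
    unfolding is_arg_min_linorder using relaxed[OF \<Gamma>] relaxed_min by blast
  moreover have "is_arg_min (\<lambda>(y', \<Gamma>'). kmeans_objective x y' \<Gamma>')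
      (\<lambda>(y', \<Gamma>'). \<Gamma>' \<in> assignment_matrices) (y, \<Gamma>)"
  proof -
    have "kmeans_objective x y \<Gamma> \<le> kmeans_objective x y' \<Gamma>'" if "\<Gamma>' \<in> assignment_matrices"
      for y' and \<Gamma>' :: "real^'k^'n"
      unfolding eq using \<Gamma>_min[OF that] kmeans_ge[OF that] by (rule order_trans)
    then show ?thesis
      unfolding is_arg_min_linorder using \<Gamma> by simp
  qed
  ultimately show ?thesis
    by (intro conjI exI[of _ \<Gamma>] exI[of _ y] convex_relaxed concave_on_concave_objective \<Gamma> eq)
qed

end
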